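(* Let $\mathcal{G}$ be the subgroup of the symmetric group $\mathrm{Sym}(\{0,1,2\}^{18})$ (on $3^{18}$ points) generated by the set $\{T_k:k\in\{0,1,2\}^{20}\}$ of E-DES encryption permutations. Then $\mathcal{G}$ contains as many even permutations as odd permutations.
   Context: Definition of E-DES. All entries ("nits") lie in $\mathbb{Z}_3=\{0,1,2\}$; $\oplus$ denotes entrywise addition modulo 3. The message space and ciphertext space are $\{0,1,2\}^{18}$, the key space is $\{0,1,2\}^{20}$. A list $(a_1,\dots,a_r)$ of positions acts on a string $s$ by producing the string $s_{a_1}s_{a_2}\cdots s_{a_r}$. Key schedule: for a key $k$ the 15-nit subkeys $k_1,k_2$ are obtained by applying to $k$ the lists $CP_1=(16,17,12,15,20,10,11,3,7,19,13,9,8,1,18)$ and $CP_2=(6,7,2,20,4,3,9,8,18,10,15,14,11,12,5)$ respectively. Initial permutation: $P$ applies the list $(11,12,2,13,9,1,5,8,16,17,4,18,15,7,10,3,6,14)$ to an 18-nit string; $P^{-1}$ is its inverse. Expansion: $E:\{0,1,2\}^9\to\{0,1,2\}^{15}$ applies the list $(9,1,2,3,4,5,6,3,4,5,6,7,8,9,1)$. Round function: for a 15-nit subkey $\kappa$ and $R\in\{0,1,2\}^9$, form $E(R)\oplus\kappa$ and split it into three consecutive 5-nit blocks. Block number $p$ ($p=1,2,3$), say $n_1n_2n_3n_4n_5$, selects the entry of S-box $p$ in row $3n_1+n_5$ (rows numbered 0 to 8) and column $9n_2+3n_3+n_4$ (columns numbered 0 to 26); this entry, an integer between 0 and 26, is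 written as a 3-digit base-3 string (most significant digit first). Then $f_\kappa(R)\in\{0,1,2\}^9$ is the concatenation of the outputs of S-boxes 1, 2, 3 in this order. Encryption: with $\sigma_f(x,y)=(y,x\oplus f(y))$ and $\theta(x,y)=(y,x)$ for $x,y\in\{0,1,2\}^9$ (left and right halves), $T_k=P^{-1}\circ\theta\circ\sigma_{f_{k_2}}\circ\sigma_{f_{k_1}}\circ P$. S-box 1 (rows 0 to 8): row 0: 24,25,6,16,3,7,1,18,26,5,10,9,19,23,13,12,15,8,20,17,2,11,0,21,14,4,22 row 1: 17,18,26,9,23,0,21,11,19,25,3,2,12,16,6,5,8,1,13,10,22,4,20,14,7,24,15 row 2: 16,17,25,8,22,26,20,10,18,24,2,1,11,15,5,4,7,0,12,9,21,3,19,13,6,23,14 row 3: 10,11,19,2,16,20,14,4,12,18,23,22,5,9,26,25,1,21,6,3,15,24,13,7,0,17,8 row 4: 21,22,3,23,0,4,25,15,23,2,7,6,16,20,10,9,12,5,17,14,26,8,24,18,11,1,19 row 5: 26,0,8,18,5,9,3,20,1,7,12,11,21,25,15,14,17,10,22,19,4,13,2,23,16,6,24 row 6: 3,4,12,22,9,13,7,24,5,11,16,15,25,2,19,18,21,14,26,23,8,17,6,0,20,10,1 row 7: 5,6,14,24,11,15,9,26,7,13,18,17,0,4,21,20,23,16,1,25,10,19,8,2,22,12,3 row 8: 11,12,20,3,17,21,15,5,13,19,24,23,6,10,0,26,2,22,7,4,16,25,14,8,1,18,9 S-box 2 (rows 0 to 8): row 0: 1,2,10,20,7,11,5,22,3,9,14,13,23,0,17,16,19,12,24,21,6,15,4,25,18,8,26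 row 1: 25,26,7,17,22,8,2,19,0,6,11,10,20,24,14,13,16,9,21,18,3,12,1,22,15,5,23 row 2: 14,15,23,6,20,24,18,8,16,22,0,26,9,13,3,2,5,25,10,7,19,1,17,11,4,21,12 row 3: 9,10,18,1,15,19,13,3,11,17,22,21,4,8,25,24,0,20,5,2,14,23,12,6,26,16,7 row 4: 23,24,5,15,2,6,0,17,25,4,9,8,18,22,12,11,14,7,19,16,1,10,26,20,13,3,21 row 5: 2,3,11,21,8,12,6,23,4,10,15,14,24,1,18,17,20,13,25,22,7,16,5,26,19,9,0 row 6: 18,19,0,10,24,1,22,12,20,26,4,3,13,17,7,6,9,2,14,11,23,5,21,15,8,25,16 row 7: 15,16,24,7,21,25,19,9,17,23,1,0,10,14,4,3,6,9,13,8,20,2,18,12,5,22,13 row 8: 2,23,4,14,1,5,26,16,24,3,8,7,17,21,11,10,13,16,18,15,0,9,25,19,12,2,20 S-box 3 (rows 0 to 8): row 0: 4,5,13,23,10,14,8,25,6,12,17,16,26,3,20,19,22,15,0,24,9,18,7,1,21,11,2 row 1: 6,7,15,25,12,16,10,0,8,14,19,18,1,5,22,21,24,17,2,26,11,20,9,3,23,13,4 row 2: 7,8,16,26,13,17,11,1,9,15,20,19,2,6,23,22,25,18,3,0,12,21,10,4,24,14,5 row 3: 8,9,17,0,14,18,12,2,10,16,21,20,3,7,24,23,26,19,4,1,13,22,11,5,25,15,6 row 4: 13,14,22,5,19,23,17,7,15,21,26,25,8,12,2,1,4,24,9,6,18,0,16,10,3,20,11 row 5: 12,13,21,4,18,22,16,6,14,20,25,24,7,11,1,0,3,23,8,5,17,26,15,9,2,19,10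 row 6: 19,20,1,11,25,2,23,13,21,0,5,4,14,18,10,7,10,3,15,12,24,6,22,16,9,26,17 row 7: 0,1,9,19,6,10,4,21,2,8,13,12,22,26,16,15,18,11,23,20,5,14,3,24,17,7,25 row 8: 20,21,2,12,26,3,24,14,22,1,6,5,15,19,9,8,11,4,16,13,25,7,23,17,10,0,18 *)

theory Defs
  imports "HOL-Algebra.Sym_Groups" "HOL-Combinatorics.Orbits"
begin

definition nit_strings :: "nat \<Rightarrow> nat list set" where
  "nit_strings n = {s. set s \<subseteq> {0, 1, 2} \<and> length s = n}"

definition nit_add :: "nat list \<Rightarrow> nat list \<Rightarrow> nat list"  (infixl "\<oplus>\<^sub>3" 65) where
  "s \<oplus>\<^sub>3 t = map2 (\<lambda>a b. (a + b) mod 3) s t"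

(* Positions are counted from 1, whereas list indexing starts at 0. *)
definition select :: "nat list \<Rightarrow> nat list \<Rightarrow> nat list" where
  "select as s = map (\<lambda>a. s ! (a - 1)) as"

definition subkey1 :: "nat list \<Rightarrow> nat list" where
  "subkey1 = select [16,17,12,15,20,10,11,3,7,19,13,9,8,1,18]"

definition subkey2 :: "nat list \<Rightarrow> nat list" where
  "subkey2 = select [6,7,2,20,4,3,9,8,18,10,15,14,11,12,5]"

definition initial_perm :: "nat list \<Rightarrow> nat list" where
  "initial_perm = select [11,12,2,13,9,1,5,8,16,17,4,18,15,7,10,3,6,14]"

definition final_perm :: "nat list \<Rightarrow> nat list" where
  "final_perm = inv_into (nit_strings 18) initial_perm"

definition expansion :: "nat list \<Rightarrow> nat list" where
  "expansion = select [9,1,2,3,4,5,6,3,4,5,6,7,8,9,1]"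

definition sbox1 :: "nat list list" where
  "sbox1 =
   [[24,25,6,16,3,7,1,18,26,5,10,9,19,23,13,12,15,8,20,17,2,11,0,21,14,4,22],
    [17,18,26,9,23,0,21,11,19,25,3,2,12,16,6,5,8,1,13,10,22,4,20,14,7,24,15],
    [16,17,25,8,22,26,20,10,18,24,2,1,11,15,5,4,7,0,12,9,21,3,19,13,6,23,14],
    [10,11,19,2,16,20,14,4,12,18,23,22,5,9,26,25,1,21,6,3,15,24,13,7,0,17,8],
    [21,22,3,23,0,4,25,15,23,2,7,6,16,20,10,9,12,5,17,14,26,8,24,18,11,1,19],
    [26,0,8,18,5,9,3,20,1,7,12,11,21,25,15,14,17,10,22,19,4,13,2,23,16,6,24],
    [3,4,12,22,9,13,7,24,5,11,16,15,25,2,19,18,21,14,26,23,8,17,6,0,20,10,1],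
    [5,6,14,24,11,15,9,26,7,13,18,17,0,4,21,20,23,16,1,25,10,19,8,2,22,12,3],
    [11,12,20,3,17,21,15,5,13,19,24,23,6,10,0,26,2,22,7,4,16,25,14,8,1,18,9]]"

definition sbox2 :: "nat list list" where
  "sbox2 =
   [[1,2,10,20,7,11,5,22,3,9,14,13,23,0,17,16,19,12,24,21,6,15,4,25,18,8,26],
    [25,26,7,17,22,8,2,19,0,6,11,10,20,24,14,13,16,9,21,18,3,12,1,22,15,5,23],
    [14,15,23,6,20,24,18,8,16,22,0,26,9,13,3,2,5,25,10,7,19,1,17,11,4,21,12],
    [9,10,18,1,15,19,13,3,11,17,22,21,4,8,25,24,0,20,5,2,14,23,12,6,26,16,7],
    [23,24,5,15,2,6,0,17,25,4,9,8,18,22,12,11,14,7,19,16,1,10,26,20,13,3,21],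
    [2,3,11,21,8,12,6,23,4,10,15,14,24,1,18,17,20,13,25,22,7,16,5,26,19,9,0],
    [18,19,0,10,24,1,22,12,20,26,4,3,13,17,7,6,9,2,14,11,23,5,21,15,8,25,16],
    [15,16,24,7,21,25,19,9,17,23,1,0,10,14,4,3,6,9,13,8,20,2,18,12,5,22,13],
    [2,23,4,14,1,5,26,16,24,3,8,7,17,21,11,10,13,16,18,15,0,9,25,19,12,2,20]]"

definition sbox3 :: "nat list list" where
  "sbox3 =
   [[4,5,13,23,10,14,8,25,6,12,17,16,26,3,20,19,22,15,0,24,9,18,7,1,21,11,2],
    [6,7,15,25,12,16,10,0,8,14,19,18,1,5,22,21,24,17,2,26,11,20,9,3,23,13,4],
    [7,8,16,26,13,17,11,1,9,15,20,19,2,6,23,22,25,18,3,0,12,21,10,4,24,14,5],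
    [8,9,17,0,14,18,12,2,10,16,21,20,3,7,24,23,26,19,4,1,13,22,11,5,25,15,6],
    [13,14,22,5,19,23,17,7,15,21,26,25,8,12,2,1,4,24,9,6,18,0,16,10,3,20,11],
    [12,13,21,4,18,22,16,6,14,20,25,24,7,11,1,0,3,23,8,5,17,26,15,9,2,19,10],
    [19,20,1,11,25,2,23,13,21,0,5,4,14,18,10,7,10,3,15,12,24,6,22,16,9,26,17],
    [0,1,9,19,6,10,4,21,2,8,13,12,22,26,16,15,18,11,23,20,5,14,3,24,17,7,25],
    [20,21,2,12,26,3,24,14,22,1,6,5,15,19,9,8,11,4,16,13,25,7,23,17,10,0,18]]"

definition base3_digits :: "nat \<Rightarrow> nat list" where
  "base3_digits v = [v div 9 mod 3, v div 3 mod 3, v mod 3]"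

definition sbox_output :: "nat list list \<Rightarrow> nat list \<Rightarrow> nat list" where
  "sbox_output S n = base3_digits
     (S ! (3 * n ! 0 + n ! 4) ! (9 * n ! 1 + 3 * n ! 2 + n ! 3))"

definition round_function :: "nat list \<Rightarrow> nat list \<Rightarrow> nat list" where
  "round_function \<kappa> R = (let b = expansion R \<oplus>\<^sub>3 \<kappa> in
     sbox_output sbox1 (take 5 b) @
     sbox_output sbox2 (take 5 (drop 5 b)) @
     sbox_output sbox3 (take 5 (drop 10 b)))"

definition halves :: "nat list \<Rightarrow> nat list \<times> nat list" where
  "halves s = (take 9 s, drop 9 s)"

definition join_halves :: "nat list \<times> nat list \<Rightarrow> nat list" where
  "join_halves = (\<lambda>(x, y). x @ y)"

definition feistel_round ::
  "(nat list \<Rightarrow> nat list) \<Rightarrow> nat list \<times> nat list \<Rightarrow> nat list \<times> nat list" where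
  "feistel_round f = (\<lambda>(x, y). (y, x \<oplus>\<^sub>3 f y))"

definition encrypt :: "nat list \<Rightarrow> nat list \<Rightarrow> nat list" where
  "encrypt k = final_perm \<circ> join_halves \<circ> prod.swap
     \<circ> feistel_round (round_function (subkey2 k))
     \<circ> feistel_round (round_function (subkey1 k))
     \<circ> halves \<circ> initial_perm"

(* Following the library convention for permutations of a subset of a type
   (permutes), a permutation of the message space is a function on all lists
   that is the identity outside the message space. *)
definition encryption_perm :: "nat list \<Rightarrow> nat list \<Rightarrow> nat list" where
  "encryption_perm k = perm_restrict (encrypt k) (nit_strings 18)"

(* Generalises the library's sym_group, which is confined to the sets {1..n}. *)
definition symmetric_group :: "'a set \<Rightarrow> ('a \<Rightarrow> 'a) monoid" where
  "symmetric_group A = \<lparr> carrier = {p. p permutes A}, mult = (\<circ>), one = id \<rparr>"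

definition edes_group :: "(nat list \<Rightarrow> nat list) set" where
  "edes_group = generate (symmetric_group (nit_strings 18)) (encryption_perm ` nit_strings 20)"

(* The lemmas below show that the encryption functions really are permutations of the
   message space, so that edes_group is a finite subgroup of its symmetric group. *)

lemma group_symmetric_group: "group (symmetric_group A)"
  using permutes_inv permutes_inv_o(2)
  by (auto intro!: groupI
        simp add: symmetric_group_def permutes_compose permutes_id comp_assoc, blast)

lemma finite_nit_strings: "finite (nit_strings n)"
  unfolding nit_strings_def by (rule finite_lists_length_eq) simp

lemma length_nit_add [simp]: "length (s \<oplus>\<^sub>3 t) = min (length s) (length t)"
  by (simp add: nit_add_def)

lemma nth_nit_add:
  "i < length s \<Longrightarrow> i < length t \<Longrightarrow> (s \<oplus>\<^sub>3 t) ! i = (s ! i + t ! i) mod 3"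
  by (simp add: nit_add_def)

lemma set_nit_add: "set (s \<oplus>\<^sub>3 t) \<subseteq> {0, 1, 2}"
proof -
  have "m mod 3 \<in> {0, 1, 2}" for m :: nat
    using mod_less_divisor[of 3 m] by auto
  then show ?thesis
    unfolding nit_add_def by auto
qed

lemma nit_cancel:
  fixes a b c :: nat
  assumes "a \<in> {0, 1, 2}" "b \<in> {0, 1, 2}" "(a + c) mod 3 = (b + c) mod 3"
  shows "a = b"
proof -
  have "c mod 3 = 0 \<or> c mod 3 = 1 \<or> c mod 3 = 2"
    by linarith
  moreover have "(a + c mod 3) mod 3 = (b + c mod 3) mod 3"
    using assms(3) by (simp add: mod_simps)
  ultimately show ?thesis
    using assms(1,2) by (elim disjE) auto
qed

lemma nit_add_cancel:
  assumes "x \<in> nit_strings n" "x' \<in> nit_strings n" "length z = n" "x \<oplus>\<^sub>3 z = x' \<oplus>\<^sub>3 z"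
  shows "x = x'"
proof (rule nth_equalityI)
  show "length x = length x'"
    using assms by (simp add: nit_strings_def)
next
  fix i assume i: "i < length x"
  then have "x ! i \<in> set x" "x' ! i \<in> set x'"
    using assms by (simp_all add: nit_strings_def)
  then have *: "x ! i \<in> {0, 1, 2}" "x' ! i \<in> {0, 1, 2}"
    using assms unfolding nit_strings_def by blast+
  have "(x ! i + z ! i) mod 3 = (x' ! i + z ! i) mod 3"
    using assms i nth_nit_add[of i x z] nth_nit_add[of i x' z] by (simp add: nit_strings_def)
  with * show "x ! i = x' ! i"
    by (rule nit_cancel)
qed

lemma length_round_function [simp]: "length (round_function \<kappa> R) = 9"
  by (simp add: round_function_def sbox_output_def base3_digits_def Let_def)

lemma bij_betw_select:
  assumes L: "length L = n" "set L = {1..n}"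
  shows "bij_betw (select L) (nit_strings n) (nit_strings n)"
proof -
  have "inj_on (select L) (nit_strings n)"
  proof (rule inj_onI)
    fix s t
    assume st: "s \<in> nit_strings n" "t \<in> nit_strings n" "select L s = select L t"
    then have *: "\<forall>a\<in>{1..n}. s ! (a - 1) = t ! (a - 1)"
      by (simp add: select_def L)
    have "s ! i = t ! i" if "i < n" for i
      using bspec[OF *, of "Suc i"] that by simp
    with st(1,2) show "s = t"
      by (intro nth_equalityI) (auto simp: nit_strings_def)
  qed
  moreover have "select L s \<in> nit_strings n" if s: "s \<in> nit_strings n" for s
  proof -
    have "s ! (a - 1) \<in> set s" if "a \<in> {1..n}" for a
      using that s by (intro nth_mem) (auto simp: nit_strings_def)
    then have "set (select L s) \<subseteq> set s"
      by (auto simp: select_def L)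
    then have "set (select L s) \<subseteq> {0, 1, 2}"
      using s unfolding nit_strings_def by blast
    then show ?thesis
      by (simp add: nit_strings_def select_def L)
  qed
  ultimately show ?thesis
    unfolding bij_betw_def by (intro conjI endo_inj_surj finite_nit_strings image_subsetI)
qed

lemma bij_betw_initial_perm: "bij_betw initial_perm (nit_strings 18) (nit_strings 18)"
  unfolding initial_perm_def
proof (rule bij_betw_select)
  have "{1..18::nat} = set [1..<19]"
    by auto
  also have "\<dots> = set [11,12,2,13,9,1,5,8,16,17,4,18,15,7,10,3,6,14]"
    by code_simp
  finally show "set [11,12,2,13,9,1,5,8,16,17,4,18,15,7,10,3,6,14] = {1..18::nat}" ..
qed simp

lemma bij_betw_final_perm: "bij_betw final_perm (nit_strings 18) (nit_strings 18)"
  unfolding final_perm_def by (rule bij_betw_inv_into[OF bij_betw_initial_perm])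

lemma bij_betw_halves: "bij_betw halves (nit_strings 18) (nit_strings 9 \<times> nit_strings 9)"
  by (rule bij_betw_byWitness[where f' = join_halves])
    (auto simp: halves_def join_halves_def nit_strings_def
      dest: in_set_takeD in_set_dropD)

lemma bij_betw_join_halves: "bij_betw join_halves (nit_strings 9 \<times> nit_strings 9) (nit_strings 18)"
  by (rule bij_betw_byWitness[where f' = halves])
    (auto simp: halves_def join_halves_def nit_strings_def
      dest: in_set_takeD in_set_dropD)

lemma bij_betw_swap_halves: "bij_betw prod.swap (A \<times> A) (A \<times> A)"
  by (rule bij_betw_byWitness[where f' = prod.swap]) auto

lemma bij_betw_feistel_round:
  "bij_betw (feistel_round (round_function \<kappa>))
     (nit_strings 9 \<times> nit_strings 9) (nit_strings 9 \<times> nit_strings 9)"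
proof -
  have "inj_on (feistel_round (round_function \<kappa>)) (nit_strings 9 \<times> nit_strings 9)"
    by (auto simp: inj_on_def feistel_round_def intro: nit_add_cancel[OF _ _ length_round_function])
  moreover have "feistel_round (round_function \<kappa>) ` (nit_strings 9 \<times> nit_strings 9)
      \<subseteq> nit_strings 9 \<times> nit_strings 9"
    using set_nit_add by (fastforce simp: feistel_round_def nit_strings_def)
  ultimately show ?thesis
    by (simp add: bij_betw_def endo_inj_surj finite_nit_strings)
qed

lemma bij_betw_encrypt: "bij_betw (encrypt k) (nit_strings 18) (nit_strings 18)"
  unfolding encrypt_def
  by (rule bij_betw_initial_perm bij_betw_halves bij_betw_feistel_round
      bij_betw_swap_halves bij_betw_join_halves bij_betw_final_perm | rule bij_betw_trans)+

lemma encryption_perm_permutes: "encryption_perm k permutes nit_strings 18"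
proof (rule bij_imp_permutes)
  show "bij_betw (encryption_perm k) (nit_strings 18) (nit_strings 18)"
    using bij_betw_encrypt[of k]
    by (rule bij_betw_cong[THEN iffD1, rotated]) (simp add: encryption_perm_def perm_restrict_def)
qed (simp add: encryption_perm_def perm_restrict_def)

lemma subgroup_edes_group: "subgroup edes_group (symmetric_group (nit_strings 18))"
  unfolding edes_group_def
  by (rule group.generate_is_subgroup[OF group_symmetric_group])
    (auto simp: symmetric_group_def encryption_perm_permutes)

lemma finite_edes_group: "finite edes_group"
  by (rule finite_subset[OF _ finite_permutations[OF finite_nit_strings[of 18]]])
    (use subgroup.subset[OF subgroup_edes_group] in \<open>auto simp: symmetric_group_def\<close>)

end

theory Submission
  imports Defs
begin

text \<open>
  Each Feistel round is the half swap composed with the shear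
  \<open>(x, y) \<mapsto> (x \<oplus> f y, y)\<close>. The third power of the shear is the identity, so the shear is
  even, and conjugation by the initial permutation does not affect parity. Hence every encryption
  permutation has the parity of the cube of the half swap, which is a product of
  \<open>(3 ^ 18 - 3 ^ 9) div 2\<close> disjoint transpositions, an odd number. Composition with an odd
  element of the group exchanges its even and its odd elements.
\<close>

text \<open>An involution is a product of disjoint transpositions, one for each two-point orbit, so
  \<open>k\<close> counts the factors. The induction splits off one factor at a time.\<close>

lemma evenperm_involution:
  assumes "finite {x. p x \<noteq> x}" "p \<circ> p = id" "card {x. p x \<noteq> x} = 2 * k"
  shows "evenperm p \<longleftrightarrow> even k"
  using assms
proof (induction k arbitrary: p)
  case 0
  then have "p = id"
    by auto
  then show ?case
    by (simp add: evenperm_id)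
next
  case (Suc k)
  have pp: "p (p x) = x" for x
    using fun_cong[OF Suc.prems(2), of x] by simp
  have p_eq_iff: "p x = y \<longleftrightarrow> x = p y" for x y
    using pp[of x] pp[of y] by auto
  have p_inj: "p x = p y \<longleftrightarrow> x = y" for x y
    using p_eq_iff[of x "p y"] by (simp only: pp)
  have "card {x. p x \<noteq> x} \<noteq> 0"
    using Suc.prems(3) by simp
  then have "{x. p x \<noteq> x} \<noteq> {}"
    by (metis card.empty)
  then obtain a where a: "p a \<noteq> a"
    by blast
  \<comment> \<open>Composing with this transposition turns \<open>a\<close> and \<open>p a\<close>
    into fixed points and changes \<open>p\<close> nowhere else. Hence \<open>q\<close> is again an
    involution, with two fewer moved points and the opposite parity.\<close>
  define q where "q = transpose a (p a) \<circ> p"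
  have q: "q x = (if x = a \<or> x = p a then x else p x)" for x
    using p_eq_iff[of x a] by (auto simp: q_def transpose_def pp p_inj)
  have supp: "{x. q x \<noteq> x} = {x. p x \<noteq> x} - {a, p a}"
    by (auto simp: q)
  have fin: "finite {x. q x \<noteq> x}"
    using Suc.prems(1) by (simp add: supp)
  have "q (q x) = x" for x
    using p_eq_iff[of x a] by (auto simp: q pp p_inj)
  then have qq: "q \<circ> q = id"
    by (simp add: fun_eq_iff)
  have "{a, p a} \<subseteq> {x. p x \<noteq> x}" "card {a, p a} = 2"
    using a pp[of a] by auto
  then have "card {x. q x \<noteq> x} = 2 * k"
    using Suc.prems(3) by (simp add: supp card_Diff_subset)
  then have "evenperm q \<longleftrightarrow> even k"
    by (rule Suc.IH[OF fin qq])
  moreover have "permutation q"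
    using fin o_bij[OF qq qq] by (simp add: permutation)
  moreover have "p = transpose a (p a) \<circ> q"
    by (simp add: q_def comp_assoc[symmetric])
  ultimately have "evenperm p = (evenperm (transpose a (p a)) = even k)"
    using evenperm_comp[OF permutation_swap_id] by metis
  then show ?case
    using a by (simp add: evenperm_swap)
qed

text \<open>Parity is multiplicative with values in a group of order two, so \<open>p\<close> and
  its cube have the same parity.\<close>

lemma evenperm_cube_id:
  assumes "permutation p" "p \<circ> p \<circ> p = id"
  shows "evenperm p"
  using assms evenperm_comp[of "p \<circ> p" p] evenperm_comp[of p p]
  by (simp add: permutation_compose evenperm_id)

lemma perm_restrict_comp:
  assumes "g ` A \<subseteq> A"
  shows "perm_restrict (f \<circ> g) A = perm_restrict f A \<circ> perm_restrict g A"
  using assms by (auto simp: perm_restrict_def fun_eq_iff)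

lemma perm_restrict_permutes:
  assumes "bij_betw f A A"
  shows "perm_restrict f A permutes A"
proof (rule bij_imp_permutes)
  show "bij_betw (perm_restrict f A) A A"
    using assms by (rule bij_betw_cong[THEN iffD1, rotated]) (simp add: perm_restrict_def)
qed (simp add: perm_restrict_def)

lemma card_nit_strings: "card (nit_strings n) = 3 ^ n"
proof -
  have "card {0, 1, 2 :: nat} = 3"
    by simp
  then show ?thesis
    using card_lists_length_eq[of "{0, 1, 2 :: nat}" n] by (simp only: nit_strings_def finite.intros)
qed

text \<open>The three additions contribute \<open>3 * (z ! i)\<close>, which vanishes modulo 3. The
  entries of \<open>x\<close> must already be reduced for the result to be \<open>x\<close>
  itself.\<close>

lemma nit_add_thrice:
  assumes "x \<in> nit_strings n" "length z = n"
  shows "x \<oplus>\<^sub>3 z \<oplus>\<^sub>3 z \<oplus>\<^sub>3 z = x"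
proof (rule nth_equalityI)
  show "length (x \<oplus>\<^sub>3 z \<oplus>\<^sub>3 z \<oplus>\<^sub>3 z) = length x"
    using assms by (simp add: nit_strings_def)
next
  fix i assume "i < length (x \<oplus>\<^sub>3 z \<oplus>\<^sub>3 z \<oplus>\<^sub>3 z)"
  then have i: "i < length x" "i < length z"
    by simp_all
  then have "x ! i \<in> {0, 1, 2}"
    using assms(1) nth_mem[OF i(1)] unfolding nit_strings_def by blast
  then have x: "x ! i < 3"
    by auto
  have "(x \<oplus>\<^sub>3 z \<oplus>\<^sub>3 z \<oplus>\<^sub>3 z) ! i = (((x ! i + z ! i) mod 3 + z ! i) mod 3 + z ! i) mod 3"
    using i by (simp add: nth_nit_add)
  also have "\<dots> = (x ! i + 3 * (z ! i)) mod 3"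
    by presburger
  also have "\<dots> = x ! i"
    using x by simp
  finally show "(x \<oplus>\<^sub>3 z \<oplus>\<^sub>3 z \<oplus>\<^sub>3 z) ! i = x ! i" .
qed

text \<open>Transports a map on pairs to the message space and extends it by the identity, so that
  swaps, rounds and encryptions are all permutations of the same type and their parities can be
  combined.\<close>

definition on_halves ::
  "(nat list \<times> nat list \<Rightarrow> nat list \<times> nat list) \<Rightarrow> nat list \<Rightarrow> nat list" where
  "on_halves g = perm_restrict (join_halves \<circ> g \<circ> halves) (nit_strings 18)"

lemma on_halves_permutes:
  assumes "bij_betw g (nit_strings 9 \<times> nit_strings 9) (nit_strings 9 \<times> nit_strings 9)"
  shows "on_halves g permutes nit_strings 18"
  unfolding on_halves_def
  by (intro perm_restrict_permutes bij_betw_trans[OF bij_betw_halves]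
      bij_betw_trans[OF assms] bij_betw_join_halves)

lemma permutation_on_halves:
  assumes "bij_betw g (nit_strings 9 \<times> nit_strings 9) (nit_strings 9 \<times> nit_strings 9)"
  shows "permutation (on_halves g)"
  by (rule permutes_imp_permutation[OF finite_nit_strings on_halves_permutes[OF assms]])

lemma halves_join_halves: "w \<in> nit_strings 9 \<times> nit_strings 9 \<Longrightarrow> halves (join_halves w) = w"
  by (auto simp: halves_def join_halves_def nit_strings_def)

lemma join_halves_halves [simp]: "join_halves (halves s) = s"
  by (simp add: halves_def join_halves_def)

lemma halves_in: "s \<in> nit_strings 18 \<Longrightarrow> halves s \<in> nit_strings 9 \<times> nit_strings 9"
  using bij_betw_halves by (rule bij_betwE[rule_format])

lemma join_halves_in: "w \<in> nit_strings 9 \<times> nit_strings 9 \<Longrightarrow> join_halves w \<in> nit_strings 18"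
  using bij_betw_join_halves by (rule bij_betwE[rule_format])

text \<open>Between the two factors a pair is joined and split again. This gives back the pair, and
  stays inside the restricted domain, because \<open>h\<close> yields pairs of 9-nit
  strings.\<close>

lemma on_halves_comp:
  assumes "h ` (nit_strings 9 \<times> nit_strings 9) \<subseteq> nit_strings 9 \<times> nit_strings 9"
  shows "on_halves (g \<circ> h) = on_halves g \<circ> on_halves h"
proof
  fix s
  have "h (halves s) \<in> nit_strings 9 \<times> nit_strings 9" if "s \<in> nit_strings 18"
    by (rule subsetD[OF assms imageI[OF halves_in[OF that]]])
  then show "on_halves (g \<circ> h) s = (on_halves g \<circ> on_halves h) s"
    by (cases "s \<in> nit_strings 18")
      (simp_all add: on_halves_def perm_restrict_def halves_join_halves join_halves_in)
qed

lemma on_halves_eq_id: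
  assumes "\<And>w. w \<in> nit_strings 9 \<times> nit_strings 9 \<Longrightarrow> g w = w"
  shows "on_halves g = id"
  using assms[OF halves_in] by (simp add: on_halves_def perm_restrict_def fun_eq_iff)

lemma odd_swap_halves: "\<not> evenperm (on_halves prod.swap)"
proof -
  let ?N = "nit_strings 9" and ?p = "on_halves prod.swap"
  \<comment> \<open>The strings with two equal halves, which are the fixed points of the swap inside
    the message space.\<close>
  let ?D = "(\<lambda>x. join_halves (x, x)) ` ?N"
  have D: "?D \<subseteq> nit_strings 18"
    by (auto intro!: join_halves_in)
  have fixed: "?p s = s \<longleftrightarrow> s \<in> ?D" if s: "s \<in> nit_strings 18" for s
  proof -
    obtain x y where xy: "halves s = (x, y)" "x \<in> ?N" "y \<in> ?N"
      using halves_in[OF s] by (cases "halves s") auto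
    have s': "s = join_halves (x, y)"
      by (simp flip: xy(1))
    have "?p s = join_halves (y, x)"
      by (simp add: on_halves_def perm_restrict_def s xy)
    then have "?p s = s \<longleftrightarrow> x = y"
      using xy by (auto simp: s' join_halves_def nit_strings_def)
    also have "\<dots> \<longleftrightarrow> s \<in> ?D"
      using xy by (auto simp: s' join_halves_def nit_strings_def)
    finally show ?thesis .
  qed
  have "?p s = s" if "s \<notin> nit_strings 18" for s
    using that by (simp add: on_halves_def perm_restrict_def)
  with fixed have supp: "{s. ?p s \<noteq> s} = nit_strings 18 - ?D"
    by blast
  have "inj_on (\<lambda>x. join_halves (x, x)) ?N"
    by (auto simp: inj_on_def join_halves_def nit_strings_def)
  then have "card ?D = 3 ^ 9"
    by (simp add: card_image card_nit_strings)
  then have "card {s. ?p s \<noteq> s} = 3 ^ 18 - 3 ^ 9"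
    unfolding supp using D
    by (subst card_Diff_subset) (simp_all add: finite_nit_strings card_nit_strings)
  \<comment> \<open>\<open>193700403\<close> is half of \<open>3 ^ 18 - 3 ^ 9\<close>, and it is
    odd.\<close>
  then have "card {s. ?p s \<noteq> s} = 2 * 193700403"
    by simp
  moreover have "?p \<circ> ?p = id"
    by (subst on_halves_comp[symmetric]) (auto intro: on_halves_eq_id)
  moreover have "finite {s. ?p s \<noteq> s}"
    unfolding supp by (simp add: finite_nit_strings)
  ultimately show ?thesis
    using evenperm_involution[of ?p] by simp
qed

text \<open>The shear leaves the right half alone, so iterating it adds the same round function
  value to the left half each time, and three additions cancel.\<close>

lemma odd_feistel_round: "\<not> evenperm (on_halves (feistel_round (round_function \<kappa>)))"
proof -
  let ?N = "nit_strings 9" and ?f = "feistel_round (round_function \<kappa>)"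
  define shear where "shear = prod.swap \<circ> ?f"
  have bij: "bij_betw shear (?N \<times> ?N) (?N \<times> ?N)"
    unfolding shear_def by (rule bij_betw_trans[OF bij_betw_feistel_round bij_betw_swap_halves])
  then have image: "shear ` (?N \<times> ?N) \<subseteq> ?N \<times> ?N"
    by (simp add: bij_betw_def)
  have "(shear \<circ> shear \<circ> shear) w = w" if "w \<in> ?N \<times> ?N" for w
    using that by (auto simp: shear_def feistel_round_def nit_add_thrice)
  then have "on_halves (shear \<circ> shear \<circ> shear) = id"
    by (rule on_halves_eq_id)
  then have "on_halves shear \<circ> on_halves shear \<circ> on_halves shear = id"
    by (simp add: on_halves_comp image)
  then have "evenperm (on_halves shear)"
    by (rule evenperm_cube_id[OF permutation_on_halves[OF bij]])
  \<comment> \<open>The swap is its own inverse, so the round is an odd permutation times an even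
    one.\<close>
  moreover have "?f = prod.swap \<circ> shear"
    by (simp add: shear_def fun_eq_iff)
  ultimately show ?thesis
    using odd_swap_halves image bij
    by (simp add: on_halves_comp evenperm_comp permutation_on_halves bij_betw_swap_halves)
qed

lemma odd_encryption_perm: "\<not> evenperm (encryption_perm k)"
proof -
  let ?S = "nit_strings 18" and ?N = "nit_strings 9"
  let ?P = "perm_restrict initial_perm ?S" and ?Q = "perm_restrict final_perm ?S"
  let ?f1 = "feistel_round (round_function (subkey1 k))"
  let ?f2 = "feistel_round (round_function (subkey2 k))"
  have image: "?f1 ` (?N \<times> ?N) \<subseteq> ?N \<times> ?N" "(?f2 \<circ> ?f1) ` (?N \<times> ?N) \<subseteq> ?N \<times> ?N"
    using bij_betw_feistel_round bij_betw_trans[OF bij_betw_feistel_round bij_betw_feistel_round]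
    by (simp_all add: bij_betw_def)
  have bij: "bij_betw (prod.swap \<circ> (?f2 \<circ> ?f1)) (?N \<times> ?N) (?N \<times> ?N)"
    by (intro bij_betw_trans[OF _ bij_betw_swap_halves]
        bij_betw_trans[OF bij_betw_feistel_round] bij_betw_feistel_round)
  \<comment> \<open>The part of the cipher between the initial and the final permutation; it is a
    product of three odd factors.\<close>
  define R where "R = on_halves (prod.swap \<circ> (?f2 \<circ> ?f1))"
  have "R = on_halves prod.swap \<circ> (on_halves ?f2 \<circ> on_halves ?f1)"
    unfolding R_def using image by (simp add: on_halves_comp)
  then have "\<not> evenperm R"
    by (simp add: evenperm_comp permutation_compose permutation_on_halves
        bij_betw_swap_halves bij_betw_feistel_round odd_swap_halves odd_feistel_round)
  have perm: "permutation ?P" "permutation ?Q" "permutation R"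
    using perm_restrict_permutes bij_betw_initial_perm bij_betw_final_perm
      permutes_imp_permutation[OF finite_nit_strings] permutation_on_halves[OF bij]
    by (auto simp: R_def)
  have P: "initial_perm ` ?S \<subseteq> ?S"
    using bij_betw_initial_perm by (simp add: bij_betw_def)
  \<comment> \<open>Mutually inverse permutations have equal parity, so the outer factors cancel in
    the parity count and the parity of the initial permutation never has to be computed.\<close>
  have "?Q \<circ> ?P = id"
    using bij_betw_initial_perm P
    by (auto simp: fun_eq_iff perm_restrict_def final_perm_def bij_betw_def inv_into_f_f)
  then have "evenperm ?Q = evenperm ?P"
    using evenperm_comp[OF perm(2,1)] by (simp add: evenperm_id)
  have "encryption_perm k = ?Q \<circ> R \<circ> ?P"
  proof -
    let ?g = "join_halves \<circ> (prod.swap \<circ> (?f2 \<circ> ?f1)) \<circ> halves"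
    \<comment> \<open>Restriction distributes over composition only when the inner map preserves the
      set.\<close>
    have "?g ` ?S \<subseteq> ?S"
      using bij_betw_trans[OF bij_betw_halves bij_betw_trans[OF bij bij_betw_join_halves]]
      by (simp add: bij_betw_def comp_assoc)
    then have "?Q \<circ> R \<circ> ?P = perm_restrict (final_perm \<circ> ?g \<circ> initial_perm) ?S"
      unfolding R_def on_halves_def by (simp only: perm_restrict_comp P)
    then show ?thesis
      by (simp add: encryption_perm_def encrypt_def comp_assoc)
  qed
  then show ?thesis
    using \<open>\<not> evenperm R\<close> \<open>evenperm ?Q = evenperm ?P\<close> perm
    by (simp add: evenperm_comp permutation_compose)
qed

text \<open>Left composition with \<open>t\<close> is injective and maps each parity class of
  \<open>G\<close> into the other; for finite classes the two injections force equal
  cardinalities.\<close>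

lemma card_even_eq_card_odd:
  assumes finite: "finite G" and perm: "\<And>g. g \<in> G \<Longrightarrow> permutation g"
    and closed: "\<And>g h. g \<in> G \<Longrightarrow> h \<in> G \<Longrightarrow> g \<circ> h \<in> G"
    and t: "t \<in> G" "\<not> evenperm t"
  shows "card {g \<in> G. evenperm g} = card {g \<in> G. \<not> evenperm g}"
proof (rule antisym)
  have "inj t"
    using perm[OF t(1)] by (simp add: permutation bij_is_inj)
  then have inj: "inj_on ((\<circ>) t) A" for A
    by (auto simp: inj_on_def fun_eq_iff dest: injD)
  show "card {g \<in> G. evenperm g} \<le> card {g \<in> G. \<not> evenperm g}"
    by (rule card_inj_on_le[OF inj]) (use assms in \<open>auto simp: evenperm_comp\<close>)
  show "card {g \<in> G. \<not> evenperm g} \<le> card {g \<in> G. evenperm g}"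
    by (rule card_inj_on_le[OF inj]) (use assms in \<open>auto simp: evenperm_comp\<close>)
qed

theorem corollary14:
  shows "card {g \<in> edes_group. evenperm g} = card {g \<in> edes_group. \<not> evenperm g}"
proof (rule card_even_eq_card_odd[OF finite_edes_group])
  show "permutation g" if "g \<in> edes_group" for g
    using subgroup.subset[OF subgroup_edes_group] that
      permutes_imp_permutation[OF finite_nit_strings]
    by (auto simp: symmetric_group_def)
  show "g \<circ> h \<in> edes_group" if "g \<in> edes_group" "h \<in> edes_group" for g h
    using subgroup.m_closed[OF subgroup_edes_group that] by (simp add: symmetric_group_def)
  \<comment> \<open>Every key gives an odd generator; the all-zero key serves as a concrete
    one.\<close>
  have "replicate 20 0 \<in> nit_strings 20"
    by (simp add: nit_strings_def)
  then show "encryption_perm (replicate 20 0) \<in> edes_group"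
    unfolding edes_group_def by (intro generate.incl imageI)
qed (rule odd_encryption_perm)

end
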